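(* Let $p(x)=x^3-ax^2-bx-1$ be a polynomial with integer coefficients $a,b$ satisfying ($a\ge0$ and $0\le b\le a+1$) or ($a\ge2$ and $b=-1$). Assume that $p$ has a unique real root $\beta$ and that $\beta>1$. Then the set $\{\langle\!\langle\beta^n\rangle\!\rangle : n\ge0\}$ is generalised polynomial, where $\langle\!\langle r\rangle\!\rangle=\lfloor r+1/2\rfloor$ denotes the nearest integer to $r$.
   Context: The family of generalised polynomials is the smallest set of functions $\mathbb{Z}\to\mathbb{R}$ containing the polynomial maps and closed under addition, multiplication and the operation of taking the integer part $\lfloor\cdot\rfloor$. A set $E\subset\mathbb{Z}$ is called generalised polynomial if its characteristic function is a generalised polynomial. *)

theory Defs
  imports Complex_Main "HOL-Computational_Algebra.Polynomial" "HOL-Library.Indicator_Function"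
begin

inductive generalised_polynomial :: "(int \<Rightarrow> real) \<Rightarrow> bool" where
  polynomial_map: "generalised_polynomial (\<lambda>n. poly q (real_of_int n))" for q :: "real poly"
| add: "generalised_polynomial f \<Longrightarrow> generalised_polynomial g \<Longrightarrow>
    generalised_polynomial (\<lambda>n. f n + g n)"
| mult: "generalised_polynomial f \<Longrightarrow> generalised_polynomial g \<Longrightarrow>
    generalised_polynomial (\<lambda>n. f n * g n)"
| integer_part: "generalised_polynomial f \<Longrightarrow>
    generalised_polynomial (\<lambda>n. real_of_int \<lfloor>f n\<rfloor>)"

definition generalised_polynomial_set :: "int set \<Rightarrow> bool" where
  "generalised_polynomial_set E \<longleftrightarrow> generalised_polynomial (indicator E)"

end

theory Submission
  imports Defs "HOL-Computational_Algebra.Primes"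
begin

text \<open>The root \<open>\<beta>\<close> is a Pisot unit with a pair \<open>\<gamma>\<close>, \<open>cnj \<gamma>\<close> of complex conjugates, so
  \<open>round (\<beta> ^ n)\<close> is, for large \<open>n\<close>, the trace \<open>T n\<close> of \<open>\<beta> ^ n\<close>, and moreover
  \<open>T (n + 1)\<close> and \<open>T (n + 2)\<close> are the integers nearest to \<open>\<beta> * T n\<close> and \<open>\<beta>\<^sup>2 * T n\<close>.
  Hence \<open>m = T n\<close> determines \<open>\<delta> * \<beta> ^ n\<close>, with \<open>\<delta> = p'(\<beta>)\<close>, by generalised polynomial
  formulas, which make sense for every integer \<open>m\<close> and give an element \<open>x\<close> of \<open>\<int>[\<beta>]\<close>.
  That \<open>x\<close> has the norm of \<open>\<delta>\<close> and lies in prescribed residue classes are generalised polynomial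
  conditions on \<open>m\<close>. They force \<open>x / \<delta>\<close> to be a unit of norm 1 congruent to a power
  of \<open>\<beta>\<close> modulo \<open>\<beta> ^ r - 1\<close>. For \<open>r\<close> large, a comparison of norms shows that such a unit in
  \<open>[1, \<beta>)\<close> is a power of \<open>\<beta>\<close>; thus \<open>\<beta>\<close> need not be a fundamental unit. So the conditions
  describe the set up to finitely many elements.\<close>

section \<open>Generalised polynomial sets\<close>

lemma generalised_polynomial_const: "generalised_polynomial (\<lambda>_. c)"
  using polynomial_map[of "[:c:]"] by simp

lemma generalised_polynomial_of_int: "generalised_polynomial (\<lambda>n. real_of_int n)"
  using polynomial_map[of "[:0, 1:]"] by simp

lemma generalised_polynomial_cmult:
  "generalised_polynomial f \<Longrightarrow> generalised_polynomial (\<lambda>n. c * f n)"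
  by (rule mult[OF generalised_polynomial_const])

lemma generalised_polynomial_diff:
  "generalised_polynomial f \<Longrightarrow> generalised_polynomial g \<Longrightarrow>
    generalised_polynomial (\<lambda>n. f n - g n)"
  using add[OF _ generalised_polynomial_cmult[of g "-1"]] by simp

lemma generalised_polynomial_power:
  "generalised_polynomial f \<Longrightarrow> generalised_polynomial (\<lambda>n. f n ^ k)"
  by (induction k) (auto intro: generalised_polynomial_const mult)

lemma generalised_polynomial_round:
  assumes "generalised_polynomial f"
  shows "generalised_polynomial (\<lambda>n. real_of_int (round (f n)))"
  unfolding round_def by (intro integer_part add assms generalised_polynomial_const)

lemmas generalised_polynomial_intros =
  generalised_polynomial_const generalised_polynomial_of_int generalised_polynomial_diff
  generalised_polynomial_cmult generalised_polynomial_power generalised_polynomial_round add mult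

text \<open>The sum of the integer parts of x and -x is 0 if x is an integer and -1
  otherwise.\<close>

lemma generalised_polynomial_set_Ints:
  assumes "generalised_polynomial f"
  shows "generalised_polynomial_set {n. f n \<in> \<int>}"
proof -
  have "indicator {n. f n \<in> \<int>} = (\<lambda>n. 1 + (real_of_int \<lfloor>f n\<rfloor> + real_of_int \<lfloor>-1 * f n\<rfloor>))"
  proof
    fix n
    have "\<lfloor>f n\<rfloor> + \<lfloor>- f n\<rfloor> = (if f n \<in> \<int> then 0 else -1)"
      by (simp add: floor_minus ceiling_altdef)
         (metis Ints_of_int)
    then have "real_of_int \<lfloor>f n\<rfloor> + real_of_int \<lfloor>- f n\<rfloor> = (if f n \<in> \<int> then 0 else -1)"
      by (metis of_int_0 of_int_1 of_int_add of_int_minus)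
    then show "indicator {n. f n \<in> \<int>} n = 1 + (real_of_int \<lfloor>f n\<rfloor> + real_of_int \<lfloor>-1 * f n\<rfloor>)"
      by (simp add: indicator_def)
  qed
  then show ?thesis
    unfolding generalised_polynomial_set_def
    by (simp only:) (intro generalised_polynomial_intros integer_part assms)
qed

lemma sqrt_2_mult_int_Ints_iff: "sqrt 2 * real_of_int u \<in> \<int> \<longleftrightarrow> u = 0"
proof
  assume "sqrt 2 * real_of_int u \<in> \<int>"
  then obtain w where w: "sqrt 2 * real_of_int u = real_of_int w"
    by (auto elim: Ints_cases)
  have "real_of_int (2 * u\<^sup>2) = real_of_int (w\<^sup>2)"
    unfolding of_int_power w[symmetric] by (simp add: power_mult_distrib)
  then have eq: "2 * u\<^sup>2 = w\<^sup>2"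
    by (simp only: of_int_eq_iff)
  show "u = 0"
  proof (rule ccontr)
    assume "u \<noteq> 0"
    moreover have "w \<noteq> 0" using eq \<open>u \<noteq> 0\<close> by auto
    moreover have "prime_elem (2::int)" by simp
    moreover have "multiplicity 2 (2 * u\<^sup>2) = multiplicity 2 (w\<^sup>2)" using eq by simp
    \<comment> \<open>Irrationality of \<open>sqrt 2\<close> by parity: the 2-adic valuations of the
      two sides are odd and even.\<close>
    ultimately have "1 + 2 * multiplicity 2 u = 2 * multiplicity 2 w"
      by (simp add: prime_elem_multiplicity_mult_distrib prime_elem_multiplicity_power_distrib)
    then show False by presburger
  qed
qed simp

text \<open>An irrational factor turns the vanishing of an integer into integrality, which the
  integer part detects.\<close>

lemma generalised_polynomial_set_zeros:
  assumes "generalised_polynomial f" and "\<And>n. f n \<in> \<int>"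
  shows "generalised_polynomial_set {n. f n = 0}"
proof -
  have "f n = 0 \<longleftrightarrow> sqrt 2 * f n \<in> \<int>" for n
    using assms(2)[of n] by (metis Ints_cases of_int_eq_0_iff sqrt_2_mult_int_Ints_iff)
  moreover have "generalised_polynomial_set {n. sqrt 2 * f n \<in> \<int>}"
    by (intro generalised_polynomial_set_Ints generalised_polynomial_cmult assms)
  ultimately show ?thesis by simp
qed

lemma generalised_polynomial_set_Int:
  assumes "generalised_polynomial_set A" and "generalised_polynomial_set B"
  shows "generalised_polynomial_set (A \<inter> B)"
  using assms unfolding generalised_polynomial_set_def
  by (simp add: indicator_inter_arith[abs_def] mult)

lemma generalised_polynomial_set_Un:
  assumes "generalised_polynomial_set A" and "generalised_polynomial_set B"
  shows "generalised_polynomial_set (A \<union> B)"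
proof -
  have "indicator (A \<union> B) =
      (\<lambda>n. (indicator A n + indicator B n) - indicator A n * indicator B n :: real)"
    by (auto simp: indicator_def fun_eq_iff)
  then show ?thesis
    using assms unfolding generalised_polynomial_set_def
    by (simp only:) (intro generalised_polynomial_intros)
qed

lemma generalised_polynomial_set_dvd:
  assumes "generalised_polynomial (\<lambda>m. of_int (f m))" and "D \<noteq> 0"
  shows "generalised_polynomial_set {m. D dvd f m - c}"
proof -
  have "D dvd f m - c \<longleftrightarrow> 1 / of_int D * (of_int (f m) - of_int c) \<in> (\<int> :: real set)" for m
  proof -
    have "real_of_int (f m - c) / real_of_int D \<in> \<int> \<longleftrightarrow> D dvd f m - c"
      using assms(2) by (simp add: of_int_div_of_int_in_Ints_iff del: of_int_diff)
    then show ?thesis by simp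
  qed
  then show ?thesis
    by (simp only:) (intro generalised_polynomial_set_Ints generalised_polynomial_intros assms)
qed

lemma generalised_polynomial_set_empty: "generalised_polynomial_set {}"
  unfolding generalised_polynomial_set_def
  using generalised_polynomial_const[of 0] by (simp add: indicator_def[abs_def])

lemma generalised_polynomial_set_UN:
  assumes "finite I" and "\<And>i. i \<in> I \<Longrightarrow> generalised_polynomial_set (A i)"
  shows "generalised_polynomial_set (\<Union>i\<in>I. A i)"
  using assms
  by (induction I) (auto intro: generalised_polynomial_set_Un generalised_polynomial_set_empty)

lemma generalised_polynomial_set_finite:
  assumes "finite A"
  shows "generalised_polynomial_set A"
proof -
  have "generalised_polynomial_set {c}" for c
    using generalised_polynomial_set_zeros[of "\<lambda>n. real_of_int n - real_of_int c"]
    by (simp add: generalised_polynomial_intros)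
  then show ?thesis
    using generalised_polynomial_set_UN[OF assms, of "\<lambda>c. {c}"] by simp
qed

text \<open>This permits asymptotic arguments: finitely many exceptional integers can be corrected
  at the end.\<close>

lemma generalised_polynomial_set_finite_sym_diff:
  assumes "generalised_polynomial_set E" and "finite (A - E)" and "finite (E - A)"
  shows "generalised_polynomial_set A"
proof -
  have "indicator A = (\<lambda>n. (indicator E n + indicator (A - E) n) - indicator (E - A) n :: real)"
    by (auto simp: indicator_def fun_eq_iff)
  moreover have "generalised_polynomial_set (A - E)" "generalised_polynomial_set (E - A)"
    using assms by (auto intro: generalised_polynomial_set_finite)
  ultimately show ?thesis
    using assms(1) unfolding generalised_polynomial_set_def
    by (simp only:) (intro generalised_polynomial_intros)
qed

section \<open>Cubic Pisot units with complex conjugates\<close>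

lemma int_zero_if_small:
  fixes k :: int and c :: real
  assumes "\<bar>of_int k * c\<bar> < \<bar>c\<bar>"
  shows "k = 0"
proof (rule ccontr)
  assume "k \<noteq> 0"
  then have "1 \<le> \<bar>real_of_int k\<bar>" by linarith
  then have "1 * \<bar>c\<bar> \<le> \<bar>real_of_int k\<bar> * \<bar>c\<bar>" by (intro mult_right_mono) auto
  then show False using assms by (simp add: abs_mult)
qed

text \<open>\<open>Re_gamma\<close> and \<open>norm_gamma\<close> are Vieta's relations for the sum
  and the product of the roots \<beta>, \<gamma>, \<open>cnj \<gamma>\<close>; the remaining
  relation is derived as \<open>e2\<close>.\<close>

locale complex_cubic_pisot_unit =
  fixes a b :: int and \<beta> :: real and \<gamma> :: complex
  assumes beta_gt_1: "\<beta> > 1"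
    and beta_cubic: "\<beta> ^ 3 = of_int a * \<beta> ^ 2 + of_int b * \<beta> + 1"
    and Re_gamma: "2 * Re \<gamma> = of_int a - \<beta>"
    and norm_gamma: "\<beta> * cmod \<gamma> ^ 2 = 1"
    and Im_gamma: "Im \<gamma> \<noteq> 0"
begin

abbreviation B :: complex where "B \<equiv> complex_of_real \<beta>"
abbreviation \<gamma>' :: complex where "\<gamma>' \<equiv> cnj \<gamma>"

lemma beta_nonzero: "\<beta> \<noteq> 0" "B \<noteq> 0" and gamma_nonzero: "\<gamma> \<noteq> 0"
  using beta_gt_1 Im_gamma by auto

lemma e1: "of_int a = B + \<gamma> + \<gamma>'"
  using Re_gamma by (auto simp: complex_eq_iff)

lemma e3: "B * \<gamma> * \<gamma>' = 1"
  using norm_gamma unfolding mult.assoc complex_norm_square[symmetric]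
  by (metis of_real_1 of_real_mult)

lemma e2: "- of_int b = B * \<gamma> + B * \<gamma>' + \<gamma> * \<gamma>'"
proof -
  have "B ^ 3 = complex_of_real (of_int a * \<beta> ^ 2 + of_int b * \<beta> + 1)"
    unfolding beta_cubic[symmetric] by simp
  \<comment> \<open>Writing the constant term 1 as the product of the roots lets a factor
    \<open>B\<close> cancel.\<close>
  then have "B ^ 3 = of_int a * B ^ 2 + of_int b * B + B * \<gamma> * \<gamma>'"
    by (simp add: e3)
  then have "B * (- of_int b) = B * (B * \<gamma> + B * \<gamma>' + \<gamma> * \<gamma>')"
    unfolding e1 by algebra
  then show ?thesis by (rule mult_left_cancel[OF beta_nonzero(2), THEN iffD1])
qed

lemma gamma_cubic: "\<gamma> ^ 3 = of_int a * \<gamma> ^ 2 + of_int b * \<gamma> + 1"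
  using e1 e2 e3 by algebra

lemma norm_gamma_less_1: "cmod \<gamma> < 1" and norm_gamma_pos: "cmod \<gamma> > 0"
proof -
  show "cmod \<gamma> > 0" using gamma_nonzero by simp
  show "cmod \<gamma> < 1"
  proof (rule ccontr)
    assume "\<not> cmod \<gamma> < 1"
    then have "1 \<le> cmod \<gamma> ^ 2" by simp
    then have "\<beta> * 1 \<le> \<beta> * cmod \<gamma> ^ 2" using beta_gt_1 by (intro mult_left_mono) auto
    then show False using norm_gamma beta_gt_1 by simp
  qed
qed

lemma norm_gamma_power: "\<beta> ^ n * cmod (\<gamma> ^ n) ^ 2 = 1"
  using norm_gamma by (metis norm_power power_commutes power_mult_distrib power_one power_mult mult.commute)

text \<open>Elements of \<open>\<int>[\<beta>]\<close> are represented by the pair of their images under the real embedding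
  and the complex embedding \<open>\<beta> \<mapsto> \<gamma>\<close>.\<close>

definition embeds :: "real \<Rightarrow> complex \<Rightarrow> bool" where
  "embeds x x' \<longleftrightarrow> (\<exists>i j k :: int. x = of_int i + of_int j * \<beta> + of_int k * \<beta> ^ 2 \<and>
     x' = of_int i + of_int j * \<gamma> + of_int k * \<gamma> ^ 2)"

lemma embeds_of_int: "embeds (of_int i) (of_int i)"
  unfolding embeds_def by (rule exI[of _ i], rule exI[of _ 0], rule exI[of _ 0]) simp

lemma embeds_1: "embeds 1 1"
  using embeds_of_int[of 1] by simp

lemma embeds_beta: "embeds \<beta> \<gamma>"
  unfolding embeds_def by (rule exI[of _ 0], rule exI[of _ 1], rule exI[of _ 0]) simp

lemma embeds_add:
  assumes "embeds x x'" and "embeds y y'"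
  shows "embeds (x + y) (x' + y')"
proof -
  obtain i j k where 1: "x = of_int i + of_int j * \<beta> + of_int k * \<beta> ^ 2"
     "x' = of_int i + of_int j * \<gamma> + of_int k * \<gamma> ^ 2" using assms(1) unfolding embeds_def by blast
  obtain l m n where 2: "y = of_int l + of_int m * \<beta> + of_int n * \<beta> ^ 2"
     "y' = of_int l + of_int m * \<gamma> + of_int n * \<gamma> ^ 2" using assms(2) unfolding embeds_def by blast
  show ?thesis
    unfolding embeds_def 1 2
    by (rule exI[of _ "i + l"], rule exI[of _ "j + m"], rule exI[of _ "k + n"])
      (simp add: algebra_simps)
qed

lemma embeds_mult_beta:
  assumes "embeds x x'"
  shows "embeds (\<beta> * x) (\<gamma> * x')"
proof -
  obtain i j k where 1: "x = of_int i + of_int j * \<beta> + of_int k * \<beta> ^ 2"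
     "x' = of_int i + of_int j * \<gamma> + of_int k * \<gamma> ^ 2" using assms unfolding embeds_def by blast
  have "\<beta> * x = of_int k + of_int (i + b * k) * \<beta> + of_int (j + a * k) * \<beta> ^ 2"
    unfolding 1 of_int_add of_int_mult using beta_cubic by algebra
  moreover have "\<gamma> * x' = of_int k + of_int (i + b * k) * \<gamma> + of_int (j + a * k) * \<gamma> ^ 2"
    unfolding 1 of_int_add of_int_mult using gamma_cubic by algebra
  ultimately show ?thesis unfolding embeds_def by blast
qed

lemma embeds_of_int_mult:
  assumes "embeds x x'"
  shows "embeds (of_int c * x) (of_int c * x')"
proof -
  obtain i j k where 1: "x = of_int i + of_int j * \<beta> + of_int k * \<beta> ^ 2"
     "x' = of_int i + of_int j * \<gamma> + of_int k * \<gamma> ^ 2" using assms unfolding embeds_def by blast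
  show ?thesis
    unfolding embeds_def 1
    by (rule exI[of _ "c * i"], rule exI[of _ "c * j"], rule exI[of _ "c * k"])
      (simp add: algebra_simps)
qed

lemma embeds_mult:
  assumes "embeds x x'" and "embeds y y'"
  shows "embeds (x * y) (x' * y')"
proof -
  obtain i j k where 1: "x = of_int i + of_int j * \<beta> + of_int k * \<beta> ^ 2"
     "x' = of_int i + of_int j * \<gamma> + of_int k * \<gamma> ^ 2" using assms(1) unfolding embeds_def by blast
  have "embeds (of_int i * y + of_int j * (\<beta> * y) + of_int k * (\<beta> * (\<beta> * y)))
     (of_int i * y' + of_int j * (\<gamma> * y') + of_int k * (\<gamma> * (\<gamma> * y')))"
    by (intro embeds_add embeds_of_int_mult embeds_mult_beta assms)
  then show ?thesis unfolding 1 by (simp add: algebra_simps power2_eq_square)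
qed

lemma embeds_diff:
  assumes "embeds x x'" and "embeds y y'"
  shows "embeds (x - y) (x' - y')"
  using embeds_add[OF assms(1) embeds_of_int_mult[OF assms(2), of "-1"]] by simp

lemma embeds_power: "embeds x x' \<Longrightarrow> embeds (x ^ n) (x' ^ n)"
  by (induction n) (auto intro: embeds_mult embeds_1)

lemmas embeds_intros = embeds_of_int embeds_1 embeds_beta embeds_add embeds_diff embeds_mult
  embeds_power

text \<open>The constant term of the cubic is -1, so \<beta> is a unit and its inverse is a
  polynomial in \<beta>.\<close>

lemma embeds_inverse_beta: "embeds (1 / \<beta>) (1 / \<gamma>)"
proof -
  have "1 / \<beta> = \<beta> ^ 2 - of_int a * \<beta> - of_int b"
    using beta_cubic beta_nonzero by (simp add: field_simps power2_eq_square power3_eq_cube)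
  moreover have "1 / \<gamma> = \<gamma> ^ 2 - of_int a * \<gamma> - of_int b"
    using gamma_cubic gamma_nonzero by (simp add: field_simps power2_eq_square power3_eq_cube)
  ultimately show ?thesis by (simp only:) (intro embeds_intros)
qed

text \<open>This is the norm of x divided by x, the product of the two other conjugates. It is
  symmetric in \<gamma> and \<open>\<gamma>'\<close>, hence an integer polynomial in their sum
  \<open>S\<close> and product \<open>P\<close>, which lie in the ring generated by \<beta>. The
  images \<open>S'\<close> and \<open>P'\<close> are the sum and product of \<open>B\<close> and
  \<open>\<gamma>'\<close>.\<close>

lemma embeds_cofactor:
  assumes "embeds x x'"
  shows "embeds (cmod x' ^ 2) (of_real x * cnj x')"
proof -
  obtain i j k where 1: "x = of_int i + of_int j * \<beta> + of_int k * \<beta> ^ 2"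
     "x' = of_int i + of_int j * \<gamma> + of_int k * \<gamma> ^ 2" using assms unfolding embeds_def by blast
  define S P where "S = of_int a - \<beta>" and "P = \<beta> ^ 2 - of_int a * \<beta> - of_int b"
  define S' P' where "S' = of_int a - \<gamma>" and "P' = \<gamma> ^ 2 - of_int a * \<gamma> - of_int b"
  have S: "embeds S S'" and P: "embeds P P'"
    unfolding S_def P_def S'_def P'_def by (intro embeds_intros)+
  have sym: "complex_of_real S = \<gamma> + \<gamma>'" "complex_of_real P = \<gamma> * \<gamma>'"
    unfolding S_def P_def using e1 e2 by (simp, simp, algebra)
  have sym': "S' = B + \<gamma>'" "P' = B * \<gamma>'"
    unfolding S'_def P'_def using e1 e2 by (simp, simp, algebra)
  have "complex_of_real (cmod x' ^ 2) = complex_of_real (of_int i ^ 2 + of_int i * of_int j * S +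
      of_int i * of_int k * (S ^ 2 - of_int 2 * P) + of_int j ^ 2 * P + of_int j * of_int k * P * S +
      of_int k ^ 2 * P ^ 2)"
    unfolding complex_norm_square
    unfolding 1 of_real_add of_real_mult of_real_power of_real_diff sym of_real_of_int_eq
    by (simp add: algebra_simps power2_eq_square)
  then have "cmod x' ^ 2 = of_int i ^ 2 + of_int i * of_int j * S +
      of_int i * of_int k * (S ^ 2 - of_int 2 * P) + of_int j ^ 2 * P + of_int j * of_int k * P * S +
      of_int k ^ 2 * P ^ 2"
    by (simp only: of_real_eq_iff)
  moreover have "of_real x * cnj x' = of_int i ^ 2 + of_int i * of_int j * S' +
      of_int i * of_int k * (S' ^ 2 - of_int 2 * P') + of_int j ^ 2 * P' + of_int j * of_int k * P' * S' +
      of_int k ^ 2 * P' ^ 2"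
    unfolding 1 sym' by (simp add: algebra_simps power2_eq_square)
  ultimately show ?thesis
    by (simp only:) (intro embeds_intros S P)
qed

text \<open>The norm is symmetric in the three roots; \<open>sym\<close> writes it as an integer
  polynomial in their elementary symmetric functions, which are a, -b and 1.\<close>

lemma embeds_norm_Ints:
  assumes "embeds x x'"
  shows "x * cmod x' ^ 2 \<in> \<int>"
proof -
  obtain i j k where 1: "x = of_int i + of_int j * \<beta> + of_int k * \<beta> ^ 2"
     "x' = of_int i + of_int j * \<gamma> + of_int k * \<gamma> ^ 2" using assms unfolding embeds_def by blast
  have sym: "(i + j * x + k * x\<^sup>2) * (i + j * y + k * y\<^sup>2) * (i + j * z + k * z\<^sup>2) =
    i^3 + i^2 * j * s1 + i^2 * k * (s1^2 - 2 * s2) + i * j^2 * s2 + i * j * k * (s1 * s2 - 3 * s3) +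
    i * k^2 * (s2^2 - 2 * s1 * s3) + j^3 * s3 + j^2 * k * s1 * s3 + j * k^2 * s2 * s3 + k^3 * s3^2"
    if "s1 = x + y + z" "s2 = x * y + x * z + y * z" "s3 = x * y * z"
    for i j k x y z s1 s2 s3 :: complex
    unfolding that by algebra
  have "complex_of_real (x * cmod x' ^ 2) =
     (of_int i + of_int j * B + of_int k * B\<^sup>2) * (of_int i + of_int j * \<gamma> + of_int k * \<gamma>\<^sup>2) *
     (of_int i + of_int j * \<gamma>' + of_int k * \<gamma>'\<^sup>2)"
    unfolding of_real_mult complex_norm_square 1 by (simp add: mult.assoc)
  also have "\<dots> = of_int (i^3 + i^2 * j * a + i^2 * k * (a^2 - 2 * (-b)) + i * j^2 * (-b) +
    i * j * k * (a * (-b) - 3 * 1) +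
    i * k^2 * ((-b)^2 - 2 * a * 1) + j^3 * 1 + j^2 * k * a * 1 + j * k^2 * (-b) * 1 + k^3 * 1^2)" (is "_ = of_int ?N")
    by (subst sym[of "of_int a" B \<gamma> \<gamma>' "- of_int b" 1])
      (rule e1, rule e2, rule e3[symmetric], simp)
  finally have "complex_of_real (x * cmod x' ^ 2) = complex_of_real (real_of_int ?N)"
    unfolding of_real_of_int_eq .
  then show ?thesis by (simp only: of_real_eq_iff Ints_of_int)
qed


lemma power_norm_gamma_tendsto_0: "(\<lambda>n. cmod \<gamma> ^ n) \<longlonglongrightarrow> 0"
  using norm_gamma_less_1 by (intro LIMSEQ_realpow_zero) auto

text \<open>A nonzero element with vanishing real image would give, after multiplication by a high power
  of \<open>\<beta>\<close>, elements of \<open>\<int>[\<beta>]\<close> with zero real image and arbitrarily small nonzero complex image.\<close>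

lemma embeds_0:
  assumes "embeds 0 x'"
  shows "x' = 0"
proof -
  \<comment> \<open>With zero real image, the complex image factors as (\<gamma> - B) (j + k
    (\<gamma> + B)). Below this threshold the imaginary part of the second factor forces k = 0, and
    then its modulus forces j = 0.\<close>
  define c where "c = min 1 \<bar>Im \<gamma>\<bar> * cmod (\<gamma> - B)"
  have "\<gamma> - B \<noteq> 0" using Im_gamma by (auto simp: complex_eq_iff)
  then have "c > 0" using Im_gamma unfolding c_def by simp
  have "(\<lambda>n. cmod x' * cmod \<gamma> ^ n) \<longlonglongrightarrow> cmod x' * 0"
    by (intro tendsto_intros power_norm_gamma_tendsto_0)
  then have "eventually (\<lambda>n. cmod x' * cmod \<gamma> ^ n < c) sequentially"
    using \<open>c > 0\<close> by (auto dest: order_tendstoD)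
  then obtain n where n: "cmod x' * cmod \<gamma> ^ n < c"
    by (auto simp: eventually_sequentially)
  have "embeds (0 * \<beta> ^ n) (x' * \<gamma> ^ n)" by (intro embeds_intros assms)
  then obtain i j k where 0: "0 = real_of_int i + of_int j * \<beta> + of_int k * \<beta> ^ 2"
    and x': "x' * \<gamma> ^ n = of_int i + of_int j * \<gamma> + of_int k * \<gamma> ^ 2"
    unfolding embeds_def mult_zero_left by blast
  have "complex_of_real 0 = complex_of_real (real_of_int i + of_int j * \<beta> + of_int k * \<beta> ^ 2)"
    using 0 by simp
  then have "0 = of_int i + of_int j * B + of_int k * B ^ 2" by simp
  then have eq: "x' * \<gamma> ^ n = (\<gamma> - B) * (of_int j + of_int k * (\<gamma> + B))"
    unfolding x' by algebra
  then have "cmod (\<gamma> - B) * cmod (of_int j + of_int k * (\<gamma> + B)) < cmod (\<gamma> - B) * min 1 \<bar>Im \<gamma>\<bar>"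
    using n unfolding c_def by (metis mult.commute norm_mult norm_power)
  then have small: "cmod (of_int j + of_int k * (\<gamma> + B)) < min 1 \<bar>Im \<gamma>\<bar>"
    by (rule mult_left_less_imp_less) simp
  then have "\<bar>of_int k * Im \<gamma>\<bar> < \<bar>Im \<gamma>\<bar>"
    using abs_Im_le_cmod[of "of_int j + of_int k * (\<gamma> + B)"] by simp
  then have "k = 0" by (rule int_zero_if_small)
  moreover from small this have "\<bar>of_int j * 1\<bar> < \<bar>1::real\<bar>" by simp
  then have "j = 0" by (rule int_zero_if_small)
  ultimately show ?thesis using eq gamma_nonzero by simp
qed

text \<open>The complex image vanishes too, by \<open>embeds_0\<close>. Subtracting the two
  relations and cancelling \<gamma> - B leaves j + k (\<gamma> + B) = 0, whose imaginary part is k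
  times that of \<gamma>.\<close>

lemma coordinates_zero:
  fixes i j k :: int
  assumes "of_int i + of_int j * \<beta> + of_int k * \<beta> ^ 2 = 0"
  shows "i = 0" "j = 0" "k = 0"
proof -
  have emb: "embeds (of_int i + of_int j * \<beta> + of_int k * \<beta> ^ 2)
      (of_int i + of_int j * \<gamma> + of_int k * \<gamma> ^ 2)"
    unfolding embeds_def by blast
  then have 0: "of_int i + of_int j * \<gamma> + of_int k * \<gamma> ^ 2 = 0"
    unfolding assms by (rule embeds_0)
  have "complex_of_real (of_int i + of_int j * \<beta> + of_int k * \<beta> ^ 2) = 0"
    using assms by simp
  then have "of_int i + of_int j * B + of_int k * B ^ 2 = 0" by simp
  with 0 have "(\<gamma> - B) * (of_int j + of_int k * (\<gamma> + B)) = 0" by algebra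
  moreover have "\<gamma> - B \<noteq> 0" using Im_gamma by (auto simp: complex_eq_iff)
  ultimately have eq: "of_int j + of_int k * (\<gamma> + B) = 0" by simp
  then have "Im (of_int j + of_int k * (\<gamma> + B)) = 0" by simp
  then show k: "k = 0" using Im_gamma by simp
  show j: "j = 0" using eq k by simp
  show "i = 0" using assms j k by simp
qed

lemma coordinates_unique:
  fixes i j k i' j' k' :: int
  assumes "of_int i + of_int j * \<beta> + of_int k * \<beta> ^ 2 = of_int i' + of_int j' * \<beta> + of_int k' * \<beta> ^ 2"
  shows "k = k'"
  using coordinates_zero(3)[of "i - i'" "j - j'" "k - k'"] assms by (simp add: algebra_simps)

section \<open>Units of norm 1 congruent to a power of \<beta>\<close>

text \<open>Congruence to \<open>\<beta> ^ s\<close> modulo the ideal generated by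
  \<open>\<beta> ^ r - 1\<close>; one quotient serves both embeddings.\<close>

definition cong_power :: "nat \<Rightarrow> nat \<Rightarrow> real \<Rightarrow> complex \<Rightarrow> bool" where
  "cong_power r s x x' \<longleftrightarrow>
    (\<exists>w w'. embeds w w' \<and> x = \<beta> ^ s + (\<beta> ^ r - 1) * w \<and> x' = \<gamma> ^ s + (\<gamma> ^ r - 1) * w')"

text \<open>Division by the unit \<beta> lowers the exponent by 1. Since \<open>\<beta> ^ r\<close>
  is congruent to 1, the exponent 0 wraps around to r - 1, and the quotient then also loses
  \<open>1 / \<beta>\<close>.\<close>

lemma cong_power_div_beta:
  assumes "cong_power r s x x'" and "s < r"
  shows "\<exists>t<r. cong_power r t (x / \<beta>) (x' / \<gamma>)"
proof -
  obtain w w' where w: "embeds w w'"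
    and x: "x = \<beta> ^ s + (\<beta> ^ r - 1) * w" "x' = \<gamma> ^ s + (\<gamma> ^ r - 1) * w'"
    using assms(1) unfolding cong_power_def by blast
  have w1: "embeds (1 / \<beta> * w) (1 / \<gamma> * w')"
    by (intro embeds_mult embeds_inverse_beta w)
  show ?thesis
  proof (cases s)
    case (Suc t)
    have "cong_power r t (x / \<beta>) (x' / \<gamma>)"
      unfolding cong_power_def x Suc
      by (intro exI conjI, rule w1) (simp_all add: field_simps beta_nonzero gamma_nonzero)
    then show ?thesis using assms(2) Suc by (auto intro!: exI[of _ t])
  next
    case 0
    obtain q where q: "r = Suc q" using assms(2) by (cases r) auto
    have "cong_power r q (x / \<beta>) (x' / \<gamma>)"
      unfolding cong_power_def x 0 q
      by (intro exI conjI, rule embeds_diff[OF w1 embeds_inverse_beta])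
        (simp_all add: field_simps beta_nonzero gamma_nonzero)
    then show ?thesis using q by (auto intro!: exI[of _ q])
  qed
qed

lemma cong_power_reduce:
  assumes "r > 0" and "cong_power r s x x'"
  shows "\<exists>t<r. cong_power r t x x'"
  using assms(2)
proof (induction s rule: less_induct)
  case (less s)
  show ?case
  proof (cases "s < r")
    case False
    obtain w w' where w: "embeds w w'"
      and x: "x = \<beta> ^ s + (\<beta> ^ r - 1) * w" "x' = \<gamma> ^ s + (\<gamma> ^ r - 1) * w'"
      using less.prems unfolding cong_power_def by blast
    define t where "t = s - r"
    have s: "s = r + t" using False by (simp add: t_def)
    have "cong_power r t x x'"
      unfolding cong_power_def x s
      by (intro exI conjI, rule embeds_add[OF w embeds_power[OF embeds_beta, of t]])
        (simp_all add: algebra_simps power_add)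
    then show ?thesis using less.IH[of t] s assms(1) by simp
  qed (use less.prems in blast)
qed

text \<open>The left side bounds the norm of \<open>x - \<beta> ^ s\<close> for x of norm 1 in [1,
  \<beta>); the right side bounds the norm of \<open>\<beta> ^ r - 1\<close> from below. The
  inequality leaves no room for a nonzero multiple.\<close>

definition separating :: "nat \<Rightarrow> bool" where
  "separating r \<longleftrightarrow> r > 0 \<and> (\<forall>s<r. max (\<beta> ^ s) (\<beta> - 1) * (1 + cmod \<gamma> ^ s) ^ 2 <
      (\<beta> ^ r - 1) * (1 - cmod \<gamma> ^ r) ^ 2)"

text \<open>After division by \<open>\<beta> ^ r\<close>, with
  \<open>\<beta> ^ n * (q ^ n) ^ 2 = 1\<close>, the right side tends to 1. On the left, the term
  with \<open>\<beta> ^ s\<close> is at most \<open>(q + q ^ r) ^ 2\<close>, because r - s is at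
  least 1, and this tends to \<open>q ^ 2 < 1\<close>; the term with \<beta> - 1 tends to 0.\<close>

lemma ex_separating: "\<exists>r. separating r"
proof -
  define q where "q = cmod \<gamma>"
  have q: "0 < q" "q < 1" "\<beta> * q ^ 2 = 1"
    unfolding q_def using norm_gamma_less_1 norm_gamma_pos norm_gamma by auto
  have q0: "(\<lambda>n. q ^ n) \<longlonglongrightarrow> 0" using power_norm_gamma_tendsto_0 unfolding q_def .
  have bq: "\<beta> ^ n * (q ^ n) ^ 2 = 1" for n
    using norm_gamma_power[of n] by (simp add: q_def norm_power)
  have rhs: "(\<lambda>r. (1 - (q ^ r) ^ 2) * (1 - q ^ r) ^ 2) \<longlonglongrightarrow> (1 - 0 ^ 2) * (1 - 0) ^ 2"
    by (intro tendsto_intros q0)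
  have "(\<lambda>r. (q + q ^ r) ^ 2) \<longlonglongrightarrow> (q + 0) ^ 2" by (intro tendsto_intros q0)
  then have lim1: "(\<lambda>r. (1 - (q ^ r) ^ 2) * (1 - q ^ r) ^ 2 - (q + q ^ r) ^ 2) \<longlonglongrightarrow>
      (1 - 0 ^ 2) * (1 - 0) ^ 2 - (q + 0) ^ 2"
    by (intro tendsto_diff rhs)
  have lim2: "(\<lambda>r. (1 - (q ^ r) ^ 2) * (1 - q ^ r) ^ 2 - \<beta> * 4 * (q ^ r) ^ 2) \<longlonglongrightarrow>
      (1 - 0 ^ 2) * (1 - 0) ^ 2 - \<beta> * 4 * 0 ^ 2"
    by (intro tendsto_diff rhs) (intro tendsto_intros q0)
  have "q ^ 2 < 1" using q by (simp add: power_less_one_iff)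
  then have "eventually (\<lambda>r. (1 - (q ^ r) ^ 2) * (1 - q ^ r) ^ 2 - (q + q ^ r) ^ 2 > 0 \<and>
      (1 - (q ^ r) ^ 2) * (1 - q ^ r) ^ 2 - \<beta> * 4 * (q ^ r) ^ 2 > 0 \<and> r > 0) sequentially"
    by (intro eventually_conj order_tendstoD(1)[OF lim1] order_tendstoD(1)[OF lim2]
        eventually_gt_at_top) auto
  then obtain r where r: "(1 - (q ^ r) ^ 2) * (1 - q ^ r) ^ 2 > (q + q ^ r) ^ 2"
      "(1 - (q ^ r) ^ 2) * (1 - q ^ r) ^ 2 > \<beta> * 4 * (q ^ r) ^ 2" "r > 0"
    by (auto simp: eventually_sequentially)
  have "separating r"
    unfolding separating_def q_def[symmetric]
  proof (intro conjI allI impI r(3))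
    fix s assume "s < r"
    have bpos: "\<beta> ^ r > 0" using beta_gt_1 by simp
    have R: "\<beta> ^ r * ((1 - (q ^ r) ^ 2) * (1 - q ^ r) ^ 2) = (\<beta> ^ r - 1) * (1 - q ^ r) ^ 2"
      unfolding mult.assoc[symmetric] right_diff_distrib bq by simp
    have qs: "q ^ s \<le> 1" "0 \<le> q ^ s" using q by (auto simp: power_le_one)
    have "\<beta> ^ s * (1 + q ^ s) ^ 2 < (\<beta> ^ r - 1) * (1 - q ^ r) ^ 2"
    proof -
      define u where "u = r - s"
      have u: "r = s + u" "u \<ge> 1" using \<open>s < r\<close> by (auto simp: u_def)
      have "\<beta> ^ s * (1 + q ^ s) ^ 2 = \<beta> ^ r * (\<beta> ^ s * (q ^ r * (1 + q ^ s)) ^ 2)"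
        by (subst mult_1_left[symmetric], subst bq[of r, symmetric])
          (simp only: power_mult_distrib ac_simps)
      also have "\<beta> ^ s * (q ^ r * (1 + q ^ s)) ^ 2 =
          (\<beta> ^ s * (q ^ s) ^ 2) * (q ^ u * (1 + q ^ s)) ^ 2"
        unfolding u(1) power_add by (simp only: power_mult_distrib ac_simps)
      also have "\<dots> = (q ^ u + q ^ r) ^ 2"
        unfolding bq u(1) power_add by (simp add: algebra_simps)
      also have "\<beta> ^ r * (q ^ u + q ^ r) ^ 2 \<le> \<beta> ^ r * (q + q ^ r) ^ 2"
        using q bpos power_decreasing[OF u(2), of q]
        by (intro mult_left_mono power_mono add_mono) auto
      also have "\<dots> < \<beta> ^ r * ((1 - (q ^ r) ^ 2) * (1 - q ^ r) ^ 2)"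
        using r(1) bpos by (rule mult_strict_left_mono)
      finally show ?thesis unfolding R .
    qed
    moreover have "(\<beta> - 1) * (1 + q ^ s) ^ 2 < (\<beta> ^ r - 1) * (1 - q ^ r) ^ 2"
    proof -
      have "(\<beta> - 1) * (1 + q ^ s) ^ 2 \<le> \<beta> * (1 + 1) ^ 2"
        using qs beta_gt_1 by (intro mult_mono power_mono add_mono) auto
      also have "\<dots> = (\<beta> ^ r * (q ^ r) ^ 2) * (\<beta> * 4)"
        unfolding bq by simp
      also have "\<dots> = \<beta> ^ r * (\<beta> * 4 * (q ^ r) ^ 2)"
        by (simp only: ac_simps)
      also have "\<dots> < \<beta> ^ r * ((1 - (q ^ r) ^ 2) * (1 - q ^ r) ^ 2)"
        using r(2) bpos by (rule mult_strict_left_mono)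
      finally show ?thesis unfolding R .
    qed
    ultimately show "max (\<beta> ^ s) (\<beta> - 1) * (1 + q ^ s) ^ 2 < (\<beta> ^ r - 1) * (1 - q ^ r) ^ 2"
      by (simp add: max_def)
  qed
  then show ?thesis ..
qed

text \<open>Otherwise \<open>x - \<beta> ^ s\<close> would be a nonzero multiple of
  \<open>\<beta> ^ r - 1\<close>. The quotient has a nonzero integer as norm, so the norm of the
  multiple would be at least that of \<open>\<beta> ^ r - 1\<close>.\<close>

lemma unit_in_fundamental_interval:
  assumes r: "separating r" and s: "s < r" and cong: "cong_power r s x x'"
    and norm: "x * cmod x' ^ 2 = 1" and x: "1 \<le> x" "x < \<beta>"
  shows "x = \<beta> ^ s"
proof (rule ccontr)
  assume neq: "x \<noteq> \<beta> ^ s"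
  obtain w w' where w: "embeds w w'"
    and xw: "x = \<beta> ^ s + (\<beta> ^ r - 1) * w" "x' = \<gamma> ^ s + (\<gamma> ^ r - 1) * w'"
    using cong unfolding cong_power_def by blast
  have "r > 0" using r by (simp add: separating_def)
  have br: "\<beta> ^ r > 1" using beta_gt_1 \<open>r > 0\<close> by simp
  have "w \<noteq> 0" using neq xw by auto
  \<comment> \<open>If \<open>w' = 0\<close>, then x and \<open>\<beta> ^ s\<close> have equal norms
    and complex images of equal modulus, so they coincide.\<close>
  moreover have "w' \<noteq> 0"
  proof
    assume "w' = 0"
    then have "cmod x' = cmod (\<gamma> ^ s)" using xw by simp
    then have "x * cmod (\<gamma> ^ s) ^ 2 = \<beta> ^ s * cmod (\<gamma> ^ s) ^ 2" using norm norm_gamma_power[of s] by simp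
    then show False using neq gamma_nonzero by simp
  qed
  ultimately have "\<bar>w * cmod w' ^ 2\<bar> \<ge> 1"
    using embeds_norm_Ints[OF w] by (intro Ints_nonzero_abs_ge1) auto
  then have w1: "\<bar>w\<bar> * cmod w' ^ 2 \<ge> 1" by (simp add: abs_mult)
  have "cmod x' ^ 2 \<le> 1" using norm x by (metis mult_le_cancel_right1 zero_le_power2 not_le)
  then have x'1: "cmod x' \<le> 1" by (simp add: power_le_one_iff abs_square_le_1)
  have "1 - cmod \<gamma> ^ r \<le> cmod (\<gamma> ^ r - 1)"
    using norm_triangle_ineq2[of 1 "\<gamma> ^ r"] by (simp add: norm_power norm_minus_commute)
  moreover have "0 \<le> 1 - cmod \<gamma> ^ r" using norm_gamma_less_1 by (simp add: power_le_one)
  ultimately have "(1 - cmod \<gamma> ^ r) ^ 2 \<le> cmod (\<gamma> ^ r - 1) ^ 2" by (rule power_mono)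
  then have "(\<beta> ^ r - 1) * (1 - cmod \<gamma> ^ r) ^ 2 * 1 \<le>
      (\<beta> ^ r - 1) * cmod (\<gamma> ^ r - 1) ^ 2 * (\<bar>w\<bar> * cmod w' ^ 2)"
    using br w1 by (intro mult_mono) auto
  also have "\<dots> = \<bar>x - \<beta> ^ s\<bar> * cmod (x' - \<gamma> ^ s) ^ 2"
    using br unfolding xw by (simp add: abs_mult norm_mult power_mult_distrib)
  also have "\<dots> \<le> max (\<beta> ^ s) (\<beta> - 1) * (1 + cmod \<gamma> ^ s) ^ 2"
  proof (intro mult_mono power_mono)
    \<comment> \<open>The maximum covers two cases: \<open>\<beta> ^ s\<close> exceeds x for
      positive s, while x - 1 < \<beta> - 1 for s = 0.\<close>
    show "\<bar>x - \<beta> ^ s\<bar> \<le> max (\<beta> ^ s) (\<beta> - 1)"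
    proof (cases s)
      case (Suc t)
      then have "\<beta> \<le> \<beta> ^ s" using beta_gt_1 by (simp add: self_le_power)
      then have "\<bar>x - \<beta> ^ s\<bar> \<le> \<beta> ^ s" using x by linarith
      then show ?thesis by simp
    qed (use x in simp)
    have "cmod (x' - \<gamma> ^ s) \<le> cmod x' + cmod (\<gamma> ^ s)" by (rule norm_triangle_ineq4)
    then show "cmod (x' - \<gamma> ^ s) \<le> 1 + cmod \<gamma> ^ s" using x'1 by (simp add: norm_power)
  qed (use beta_gt_1 in auto)
  finally show False using r s unfolding separating_def by force
qed

text \<open>Descent: dividing by \<beta> keeps the norm and the congruence to some power, until x
  lies in [1, \<beta>).\<close>

lemma unit_is_power:
  assumes r: "separating r" and "s < r" and "cong_power r s x x'"
    and "x * cmod x' ^ 2 = 1" and "1 \<le> x"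
  shows "\<exists>n. x = \<beta> ^ n"
proof -
  obtain N where "x < \<beta> ^ N" using real_arch_pow[OF beta_gt_1] by blast
  then show ?thesis using assms(2-)
  proof (induction N arbitrary: s x x')
    case 0
    then show ?case by simp
  next
    case (Suc N)
    show ?case
    proof (cases "x < \<beta>")
      case True
      then show ?thesis using unit_in_fundamental_interval[OF r] Suc.prems by blast
    next
      case False
      obtain t where t: "t < r" "cong_power r t (x / \<beta>) (x' / \<gamma>)"
        using cong_power_div_beta Suc.prems by blast
      have "x / \<beta> * cmod (x' / \<gamma>) ^ 2 = x * cmod x' ^ 2 / (\<beta> * cmod \<gamma> ^ 2)"
        by (simp add: norm_divide power_divide)
      also have "\<dots> = 1" using Suc.prems norm_gamma by simp
      finally have "x / \<beta> * cmod (x' / \<gamma>) ^ 2 = 1" .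
      moreover have "x / \<beta> < \<beta> ^ N" "1 \<le> x / \<beta>"
        using Suc.prems False beta_gt_1 by (auto simp: field_simps)
      ultimately obtain n where "x / \<beta> = \<beta> ^ n" using Suc.IH t by blast
      then have "x = \<beta> ^ Suc n" using beta_nonzero by (simp add: field_simps)
      then show ?thesis by blast
    qed
  qed
qed

end

section \<open>The sequence of traces\<close>

text \<open>The power sums of the three roots by Newton's recurrence; \<open>a ^ 2 + 2 * b\<close>
  is the sum of their squares.\<close>

fun trace :: "int \<Rightarrow> int \<Rightarrow> nat \<Rightarrow> int" where
  "trace a b 0 = 3"
| "trace a b (Suc 0) = a"
| "trace a b (Suc (Suc 0)) = a ^ 2 + 2 * b"
| "trace a b (Suc (Suc (Suc n))) =
    a * trace a b (Suc (Suc n)) + b * trace a b (Suc n) + trace a b n"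

context complex_cubic_pisot_unit begin

abbreviation T :: "nat \<Rightarrow> int" where "T \<equiv> trace a b"

lemma of_int_trace: "of_int (T n) = B ^ n + \<gamma> ^ n + \<gamma>' ^ n"
proof (induction n rule: less_induct)
  case (less n)
  have cubic: "\<rho> ^ Suc (Suc (Suc m)) =
      of_int a * \<rho> ^ Suc (Suc m) + of_int b * \<rho> ^ Suc m + \<rho> ^ m"
    if "\<rho> \<in> {B, \<gamma>, \<gamma>'}" for \<rho> m
  proof -
    have "\<rho> ^ 3 = of_int a * \<rho> ^ 2 + of_int b * \<rho> + 1"
      using that e1 e2 e3 by (elim insertE emptyE; hypsubst; algebra)
    then have "\<rho> ^ 3 * \<rho> ^ m = (of_int a * \<rho> ^ 2 + of_int b * \<rho> + 1) * \<rho> ^ m"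
      by simp
    then show ?thesis by (simp add: power2_eq_square power3_eq_cube ring_distribs ac_simps)
  qed
  consider "n = 0" | "n = Suc 0" | "n = Suc (Suc 0)" | m where "n = Suc (Suc (Suc m))"
    by (metis not0_implies_Suc)
  then show ?case
  proof cases
    case 3
    have "(of_int a)\<^sup>2 + 2 * of_int b = B ^ 2 + \<gamma> ^ 2 + \<gamma>' ^ 2"
      using e1 e2 by algebra
    then show ?thesis by (simp add: 3 power2_eq_square)
  next
    case (4 m)
    then have IH: "of_int (T m) = B ^ m + \<gamma> ^ m + \<gamma>' ^ m"
      "of_int (T (Suc m)) = B ^ Suc m + \<gamma> ^ Suc m + \<gamma>' ^ Suc m"
      "of_int (T (Suc (Suc m))) = B ^ Suc (Suc m) + \<gamma> ^ Suc (Suc m) + \<gamma>' ^ Suc (Suc m)"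
      using less.IH by simp_all
    have "of_int (T n) = of_int a * of_int (T (Suc (Suc m))) + of_int b * of_int (T (Suc m)) +
        (of_int (T m) :: complex)"
      by (simp add: 4)
    also have "\<dots> = B ^ n + \<gamma> ^ n + \<gamma>' ^ n"
      unfolding IH 4 using cubic[of B m] cubic[of \<gamma> m] cubic[of \<gamma>' m]
      by (simp only: insert_iff simp_thms) (simp only: ring_distribs ac_simps)
    finally show ?thesis .
  qed (simp_all add: e1)
qed

section \<open>Recovering powers of \<beta> from traces\<close>

definition \<delta> :: real where "\<delta> = 3 * \<beta> ^ 2 - 2 * of_int a * \<beta> - of_int b"
definition \<delta>' :: complex where "\<delta>' = 3 * \<gamma> ^ 2 - 2 * of_int a * \<gamma> - of_int b"

lemma embeds_delta: "embeds \<delta> \<delta>'"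
proof -
  have "embeds (of_int 3 * \<beta> ^ 2 - of_int 2 * of_int a * \<beta> - of_int b)
      (of_int 3 * \<gamma> ^ 2 - of_int 2 * of_int a * \<gamma> - of_int b)"
    by (intro embeds_intros)
  then show ?thesis by (simp add: \<delta>_def \<delta>'_def)
qed

text \<open>The derivative of p at a root is the product of the differences to the other two roots;
  at \<beta> these are complex conjugates.\<close>

lemma delta_pos: "\<delta> > 0" and delta'_nonzero: "\<delta>' \<noteq> 0"
proof -
  have ne: "\<gamma> - B \<noteq> 0" "\<gamma> - \<gamma>' \<noteq> 0" using Im_gamma by (auto simp: complex_eq_iff)
  have "complex_of_real \<delta> = (\<gamma> - B) * cnj (\<gamma> - B)"
    unfolding \<delta>_def using e1 e2 by (simp, algebra)
  then have "\<delta> = cmod (\<gamma> - B) ^ 2"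
    unfolding complex_norm_square[symmetric] of_real_eq_iff .
  then show "\<delta> > 0" using ne by simp
  have "\<delta>' = (\<gamma> - B) * (\<gamma> - \<gamma>')"
    unfolding \<delta>'_def using e1 e2 by algebra
  then show "\<delta>' \<noteq> 0" using ne by simp
qed

text \<open>The coordinates are read off from
  \<open>p(X) / (X - \<beta>) = X\<^sup>2 + (\<beta> - a) X + (\<beta>\<^sup>2 - a \<beta> - b)\<close>, which vanishes at the conjugates
  of \<open>\<beta>\<close> and equals \<open>\<delta>\<close> at \<open>\<beta>\<close>; so \<open>elt\<close> recovers \<open>\<delta> * \<beta> ^ n\<close>
  from three consecutive traces.\<close>

definition c0 :: "int \<Rightarrow> int \<Rightarrow> int \<Rightarrow> int" where "c0 m m1 m2 = m2 - a * m1 - b * m"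
definition c1 :: "int \<Rightarrow> int \<Rightarrow> int" where "c1 m m1 = m1 - a * m"

definition elt :: "int \<Rightarrow> int \<Rightarrow> int \<Rightarrow> real" where
  "elt m m1 m2 = of_int (c0 m m1 m2) + of_int (c1 m m1) * \<beta> + of_int m * \<beta> ^ 2"
definition elt' :: "int \<Rightarrow> int \<Rightarrow> int \<Rightarrow> complex" where
  "elt' m m1 m2 = of_int (c0 m m1 m2) + of_int (c1 m m1) * \<gamma> + of_int m * \<gamma> ^ 2"

lemma embeds_elt: "embeds (elt m m1 m2) (elt' m m1 m2)"
  unfolding embeds_def elt_def elt'_def by blast

text \<open>X, Y, Z stand for the n-th powers of the roots, so that \<open>algebra\<close> sees no
  symbolic exponent.\<close>

lemma trace_identity:
  fixes X Y Z :: complex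
  shows "B * (B * X) + \<gamma> * (\<gamma> * Y) + \<gamma>' * (\<gamma>' * Z) - of_int a * (B * X + \<gamma> * Y + \<gamma>' * Z) -
      of_int b * (X + Y + Z) + (B * X + \<gamma> * Y + \<gamma>' * Z - of_int a * (X + Y + Z)) * B +
      (X + Y + Z) * B\<^sup>2 = (3 * B\<^sup>2 - 2 * of_int a * B - of_int b) * X"
    and "B * (B * X) + \<gamma> * (\<gamma> * Y) + \<gamma>' * (\<gamma>' * Z) - of_int a * (B * X + \<gamma> * Y + \<gamma>' * Z) -
      of_int b * (X + Y + Z) + (B * X + \<gamma> * Y + \<gamma>' * Z - of_int a * (X + Y + Z)) * \<gamma> +
      (X + Y + Z) * \<gamma>\<^sup>2 = (3 * \<gamma>\<^sup>2 - 2 * of_int a * \<gamma> - of_int b) * Y"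
  using e1 e2 by algebra+

lemma elt_trace: "elt (T n) (T (Suc n)) (T (Suc (Suc n))) = \<delta> * \<beta> ^ n"
proof -
  have "complex_of_real (elt (T n) (T (Suc n)) (T (Suc (Suc n)))) = complex_of_real (\<delta> * \<beta> ^ n)"
    unfolding elt_def c0_def c1_def \<delta>_def of_real_add of_real_mult of_real_diff of_int_mult of_int_diff
      of_real_of_int_eq of_real_power of_real_numeral of_int_trace power_Suc
    by (rule trace_identity(1))
  then show ?thesis by (simp only: of_real_eq_iff)
qed

lemma elt'_trace: "elt' (T n) (T (Suc n)) (T (Suc (Suc n))) = \<delta>' * \<gamma> ^ n"
  unfolding elt'_def c0_def c1_def \<delta>'_def of_int_mult of_int_diff of_int_trace power_Suc
  by (rule trace_identity(2))

lemma elt_inj: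
  assumes "elt m m1 m2 = elt n n1 n2"
  shows "m = n"
  using assms coordinates_unique unfolding elt_def by blast

text \<open>The coordinates are read modulo the norm \<open>D\<close> of \<open>\<delta> * (\<beta> ^ r - 1)\<close>, which is
  a multiple of \<open>\<delta> * (\<beta> ^ r - 1)\<close>.\<close>

lemma cong_power_of_coordinates:
  assumes D: "real_of_int D = (\<delta> * (\<beta> ^ r - 1)) * cmod (\<delta>' * (\<gamma> ^ r - 1)) ^ 2"
    and dvd: "D dvd c0 m m1 m2 - c0 (T s) (T (Suc s)) (T (Suc (Suc s)))"
      "D dvd c1 m m1 - c1 (T s) (T (Suc s))" "D dvd m - T s"
  shows "cong_power r s (elt m m1 m2 / \<delta>) (elt' m m1 m2 / \<delta>')"
proof -
  define y y' where "y = \<delta> * (\<beta> ^ r - 1)" and "y' = \<delta>' * (\<gamma> ^ r - 1)"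
  have "embeds y y'" unfolding y_def y'_def by (intro embeds_intros embeds_delta)
  then have cofactor: "embeds (cmod y' ^ 2) (of_real y * cnj y')" by (rule embeds_cofactor)
  have D1: "real_of_int D = y * cmod y' ^ 2" unfolding y_def y'_def D ..
  have "complex_of_real (real_of_int D) = complex_of_real y * (y' * cnj y')"
    unfolding D1 of_real_mult complex_norm_square ..
  \<comment> \<open>The integer \<open>D\<close> is \<open>y\<close> times its cofactor in the real
    embedding and \<open>y'\<close> times the image of that cofactor in the complex one, so both
    quotients come from one element.\<close>
  then have D2: "of_int D = y' * (of_real y * cnj y')" by (simp add: ac_simps)
  obtain u v w where uvw: "c0 m m1 m2 = c0 (T s) (T (Suc s)) (T (Suc (Suc s))) + D * u"
      "c1 m m1 = c1 (T s) (T (Suc s)) + D * v" "m = T s + D * w"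
    using dvd unfolding dvd_def by (metis diff_add_cancel add.commute)
  define z z' where "z = of_int u + of_int v * \<beta> + of_int w * \<beta> ^ 2"
    and "z' = of_int u + of_int v * \<gamma> + of_int w * \<gamma> ^ 2"
  have z: "embeds z z'" unfolding z_def z'_def embeds_def by blast
  have "elt m m1 m2 = elt (T s) (T (Suc s)) (T (Suc (Suc s))) + of_int D * z"
    unfolding elt_def z_def uvw(1,2) by (subst uvw(3)) (simp add: algebra_simps)
  then have 1: "elt m m1 m2 = \<delta> * (\<beta> ^ s + (\<beta> ^ r - 1) * (cmod y' ^ 2 * z))"
    unfolding elt_trace D1 y_def by (simp add: algebra_simps)
  have "elt' m m1 m2 = elt' (T s) (T (Suc s)) (T (Suc (Suc s))) + of_int D * z'"
    unfolding elt'_def z'_def uvw(1,2) by (subst uvw(3)) (simp add: algebra_simps)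
  also have "of_int D = \<delta>' * (\<gamma> ^ r - 1) * (of_real y * cnj y')"
    unfolding D2 y'_def ..
  finally have 2: "elt' m m1 m2 = \<delta>' * (\<gamma> ^ s + (\<gamma> ^ r - 1) * (of_real y * cnj y' * z'))"
    unfolding elt'_trace by (simp add: algebra_simps)
  show ?thesis
    unfolding cong_power_def 1 2 using embeds_mult[OF cofactor z] delta_pos delta'_nonzero
    by (intro exI[of _ "cmod y' ^ 2 * z"] exI[of _ "of_real y * cnj y' * z'"]) simp
qed

text \<open>After division by \<delta> the element has norm 1, is at least 1 and is congruent to a
  power, hence is some \<open>\<beta> ^ n\<close>. Comparing the coefficients of
  \<open>\<beta> ^ 2\<close> gives m = T n.\<close>

lemma trace_if_norm_cong:
  assumes r: "separating r"
    and D: "real_of_int D = (\<delta> * (\<beta> ^ r - 1)) * cmod (\<delta>' * (\<gamma> ^ r - 1)) ^ 2"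
    and dvd: "D dvd c0 m m1 m2 - c0 (T s) (T (Suc s)) (T (Suc (Suc s)))"
      "D dvd c1 m m1 - c1 (T s) (T (Suc s))" "D dvd m - T s"
    and norm: "elt m m1 m2 * cmod (elt' m m1 m2) ^ 2 = \<delta> * cmod \<delta>' ^ 2"
    and large: "\<delta> \<le> elt m m1 m2"
  shows "m \<in> range T"
proof -
  have "r > 0" using r by (simp add: separating_def)
  then obtain t where t: "t < r" "cong_power r t (elt m m1 m2 / \<delta>) (elt' m m1 m2 / \<delta>')"
    using cong_power_reduce cong_power_of_coordinates[OF D dvd] by blast
  have "elt m m1 m2 / \<delta> * cmod (elt' m m1 m2 / \<delta>') ^ 2 =
      elt m m1 m2 * cmod (elt' m m1 m2) ^ 2 / (\<delta> * cmod \<delta>' ^ 2)"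
    by (simp add: norm_divide power_divide)
  also have "\<dots> = 1" unfolding norm using delta_pos delta'_nonzero by simp
  finally have "elt m m1 m2 / \<delta> * cmod (elt' m m1 m2 / \<delta>') ^ 2 = 1" .
  moreover have "1 \<le> elt m m1 m2 / \<delta>" using large delta_pos by simp
  ultimately obtain n where "elt m m1 m2 / \<delta> = \<beta> ^ n"
    using unit_is_power[OF r t] by blast
  then have "elt m m1 m2 = elt (T n) (T (Suc n)) (T (Suc (Suc n)))"
    unfolding elt_trace using delta_pos by (simp add: field_simps)
  then show ?thesis using elt_inj by blast
qed

section \<open>Nearest integers in place of the next two traces\<close>

definition m1 :: "int \<Rightarrow> int" where "m1 m = round (\<beta> * of_int m)"
definition m2 :: "int \<Rightarrow> int" where "m2 m = round (\<beta> ^ 2 * of_int m)"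

text \<open>Without rounding, \<open>elt\<close> would be exactly \<delta> m; only the two rounding
  errors remain. This bounds m when \<open>elt\<close> is small.\<close>

lemma elt_approx: "\<bar>elt m (m1 m) (m2 m) - \<delta> * of_int m\<bar> \<le> 1 + \<bar>\<beta> - of_int a\<bar>"
proof -
  define r1 r2 where "r1 = of_int (m1 m) - \<beta> * of_int m" and "r2 = of_int (m2 m) - \<beta> ^ 2 * of_int m"
  have r: "\<bar>r1\<bar> \<le> 1" "\<bar>r2\<bar> \<le> 1"
    unfolding r1_def r2_def m1_def m2_def
    by (rule order_trans[OF of_int_round_abs_le], simp)+
  have "elt m (m1 m) (m2 m) - \<delta> * of_int m = r2 + (\<beta> - of_int a) * r1"
    unfolding elt_def c0_def c1_def \<delta>_def r1_def r2_def by (simp add: algebra_simps power2_eq_square)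
  also have "\<bar>\<dots>\<bar> \<le> \<bar>r2\<bar> + \<bar>\<beta> - of_int a\<bar> * \<bar>r1\<bar>"
    by (metis abs_mult abs_triangle_ineq)
  also have "\<dots> \<le> 1 + \<bar>\<beta> - of_int a\<bar> * 1"
    using r by (intro add_mono mult_left_mono) auto
  finally show ?thesis by simp
qed

text \<open>The error \<open>e n\<close> of T n against \<open>\<beta> ^ n\<close> tends to 0, hence
  so do those of \<beta> T n and \<open>\<beta> ^ 2\<close> T n against the next two traces; once
  below 1/2 they disappear in rounding.\<close>

lemma eventually_round:
  "eventually (\<lambda>n. round (\<beta> ^ n) = T n \<and> m1 (T n) = T (Suc n) \<and> m2 (T n) = T (Suc (Suc n)))
    sequentially"
proof -
  define e where "e n = 2 * Re (\<gamma> ^ n)" for n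
  have T: "real_of_int (T n) = \<beta> ^ n + e n" for n
  proof -
    have "Re (of_int (T n)) = Re (B ^ n + \<gamma> ^ n + \<gamma>' ^ n)" unfolding of_int_trace ..
    moreover have "Re (\<gamma>' ^ n) = Re (\<gamma> ^ n)" by (simp flip: complex_cnj_power)
    ultimately show ?thesis unfolding e_def by (simp flip: of_real_power)
  qed
  have "(\<lambda>n. \<gamma> ^ n) \<longlonglongrightarrow> 0" by (rule LIMSEQ_power_zero) (rule norm_gamma_less_1)
  then have "e \<longlonglongrightarrow> 2 * Re 0" unfolding e_def
    by (intro tendsto_mult tendsto_const tendsto_Re)
  then have e: "e \<longlonglongrightarrow> 0" by simp
  have "(\<lambda>n. \<beta> * e n - e (Suc n)) \<longlonglongrightarrow> \<beta> * 0 - 0"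
    and "(\<lambda>n. \<beta> ^ 2 * e n - e (Suc (Suc n))) \<longlonglongrightarrow> \<beta> ^ 2 * 0 - 0"
    by (intro tendsto_diff tendsto_mult tendsto_const e LIMSEQ_Suc[OF LIMSEQ_Suc[OF e]] LIMSEQ_Suc[OF e])+
  then have "(\<lambda>n. \<beta> * e n - e (Suc n)) \<longlonglongrightarrow> 0" "(\<lambda>n. \<beta> ^ 2 * e n - e (Suc (Suc n))) \<longlonglongrightarrow> 0"
    by simp_all
  with e have "eventually (\<lambda>n. dist (e n) 0 < 1 / 2 \<and> dist (\<beta> * e n - e (Suc n)) 0 < 1 / 2 \<and>
      dist (\<beta> ^ 2 * e n - e (Suc (Suc n))) 0 < 1 / 2) sequentially"
    by (intro eventually_conj tendstoD) auto
  then show ?thesis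
  proof eventually_elim
    case (elim n)
    have "round (\<beta> ^ n) = T n"
      by (rule round_unique') (use elim T in simp)
    moreover have "m1 (T n) = T (Suc n)"
      unfolding m1_def by (rule round_unique') (use elim in \<open>simp add: T algebra_simps\<close>)
    moreover have "m2 (T n) = T (Suc (Suc n))"
      unfolding m2_def
      by (rule round_unique') (use elim in \<open>simp add: T algebra_simps power2_eq_square\<close>)
    ultimately show ?case by blast
  qed
qed

lemma generalised_polynomial_norm:
  "generalised_polynomial (\<lambda>m. elt m (m1 m) (m2 m) * cmod (elt' m (m1 m) (m2 m)) ^ 2)"
proof -
  have Re: "Re (elt' m (m1 m) (m2 m)) =
      of_int (c0 m (m1 m) (m2 m)) + Re \<gamma> * of_int (c1 m (m1 m)) + Re (\<gamma> ^ 2) * of_int m"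
    and Im: "Im (elt' m (m1 m) (m2 m)) =
      Im \<gamma> * of_int (c1 m (m1 m)) + Im (\<gamma> ^ 2) * of_int m" for m
    unfolding elt'_def by simp_all
  show ?thesis
    unfolding cmod_power2 Re Im
    unfolding elt_def c0_def c1_def m1_def m2_def of_int_diff of_int_mult
    by (intro generalised_polynomial_intros)
qed

lemma generalised_polynomial_coordinates:
  "generalised_polynomial (\<lambda>m. of_int (c0 m (m1 m) (m2 m)))"
  "generalised_polynomial (\<lambda>m. of_int (c1 m (m1 m)))"
  unfolding c0_def c1_def m1_def m2_def of_int_diff of_int_mult
  by (intro generalised_polynomial_intros)+

section \<open>The description of the set up to finitely many elements\<close>

lemma generalised_polynomial_set_round_power:
  "generalised_polynomial_set {round (\<beta> ^ n) | n :: nat. True}"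
proof -
  obtain r where r: "separating r" using ex_separating ..
  then have "r > 0" by (simp add: separating_def)
  define y y' where "y = \<delta> * (\<beta> ^ r - 1)" and "y' = \<delta>' * (\<gamma> ^ r - 1)"
  have "embeds y y'" unfolding y_def y'_def by (intro embeds_intros embeds_delta)
  then obtain D where D: "real_of_int D = y * cmod y' ^ 2"
    using embeds_norm_Ints by (metis Ints_cases)
  have "\<beta> ^ r - 1 > 0" using beta_gt_1 \<open>r > 0\<close> by simp
  moreover have "cmod (\<gamma> ^ r) < 1"
    unfolding norm_power using norm_gamma_less_1 \<open>r > 0\<close> by (simp add: power_less_one_iff)
  then have "\<gamma> ^ r \<noteq> 1" by auto
  ultimately have "real_of_int D > 0"
    unfolding D y_def y'_def using delta_pos delta'_nonzero by simp
  then have "D > 0" by simp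
  define c where "c s = (c0 (T s) (T (Suc s)) (T (Suc (Suc s))), c1 (T s) (T (Suc s)), T s)" for s
  \<comment> \<open>Only finitely many residue triples modulo \<open>D\<close> occur among the
    coordinates of \<open>\<delta> * \<beta> ^ s\<close>, so the condition for some s becomes a
    finite union.\<close>
  define S where "S = (\<lambda>(i, j, k). (i mod D, j mod D, k mod D)) ` range c"
  define E1 where "E1 = {m. elt m (m1 m) (m2 m) * cmod (elt' m (m1 m) (m2 m)) ^ 2 - \<delta> * cmod \<delta>' ^ 2 = 0}"
  define E2 where "E2 = (\<Union>(i, j, k)\<in>S. {m. D dvd c0 m (m1 m) (m2 m) - i} \<inter>
      {m. D dvd c1 m (m1 m) - j} \<inter> {m. D dvd m - k})"
  have "S \<subseteq> {0..<D} \<times> {0..<D} \<times> {0..<D}" unfolding S_def using \<open>D > 0\<close> by auto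
  then have "finite S" by (rule finite_subset) simp
  then have "generalised_polynomial_set E2"
    unfolding E2_def using \<open>D > 0\<close>
    by (intro generalised_polynomial_set_UN)
      (auto intro!: generalised_polynomial_set_Int generalised_polynomial_set_dvd
        generalised_polynomial_coordinates generalised_polynomial_of_int)
  moreover have "generalised_polynomial_set E1"
    unfolding E1_def
    by (intro generalised_polynomial_set_zeros generalised_polynomial_diff generalised_polynomial_norm
        generalised_polynomial_const Ints_diff embeds_norm_Ints embeds_elt embeds_delta)
  ultimately have E: "generalised_polynomial_set (E1 \<inter> E2)" by (intro generalised_polynomial_set_Int)
  have E2_iff: "m \<in> E2 \<longleftrightarrow> (\<exists>s. D dvd c0 m (m1 m) (m2 m) - c0 (T s) (T (Suc s)) (T (Suc (Suc s))) \<and>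
      D dvd c1 m (m1 m) - c1 (T s) (T (Suc s)) \<and> D dvd m - T s)" for m
    unfolding E2_def S_def c_def
    by (auto simp: mod_eq_dvd_iff[symmetric])
  obtain N where N: "\<And>n. n \<ge> N \<Longrightarrow> round (\<beta> ^ n) = T n \<and> m1 (T n) = T (Suc n) \<and> m2 (T n) = T (Suc (Suc n))"
    using eventually_round unfolding eventually_sequentially by blast
  define A where "A = {round (\<beta> ^ n) | n :: nat. True}"
  \<comment> \<open>The bound on the modulus of m that \<open>elt_approx\<close> gives when
    \<open>elt\<close> lies between 0 and \<delta>.\<close>
  define K where "K = 1 + (1 + \<bar>\<beta> - of_int a\<bar>) / \<delta>"
  have TE: "T n \<in> E1 \<inter> E2" if "n \<ge> N" for n
  proof
    show "T n \<in> E2" unfolding E2_iff using N[OF that] by (intro exI[of _ n]) simp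
    have "\<delta> * \<beta> ^ n * cmod (\<delta>' * \<gamma> ^ n) ^ 2 = \<delta> * cmod \<delta>' ^ 2 * (\<beta> ^ n * cmod (\<gamma> ^ n) ^ 2)"
      by (simp add: norm_mult power_mult_distrib)
    then show "T n \<in> E1"
      unfolding E1_def using N[OF that] by (simp add: elt_trace elt'_trace norm_gamma_power)
  qed
  have "A - E1 \<inter> E2 \<subseteq> (\<lambda>n. round (\<beta> ^ n)) ` {..<N}"
  proof (intro subsetI)
    fix m assume "m \<in> A - E1 \<inter> E2"
    then obtain n where "m = round (\<beta> ^ n)" "m \<notin> E1 \<inter> E2" unfolding A_def by blast
    moreover from this have "n < N" using TE[of n] N[of n] by (metis not_le)
    ultimately show "m \<in> (\<lambda>n. round (\<beta> ^ n)) ` {..<N}" by blast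
  qed
  then have "finite (A - E1 \<inter> E2)" by (rule finite_subset) simp
  \<comment> \<open>Such an m either has \<open>elt\<close> below \<delta>, and is then bounded by
    \<open>K\<close>, or equals some T n, where n < N because later traces lie in
    \<open>A\<close>.\<close>
  moreover have "E1 \<inter> E2 - A \<subseteq> {\<lfloor>- K\<rfloor>..\<lceil>K\<rceil>} \<union> T ` {..<N}"
  proof
    fix m assume m: "m \<in> E1 \<inter> E2 - A"
    define x where "x = elt m (m1 m) (m2 m)"
    have norm: "x * cmod (elt' m (m1 m) (m2 m)) ^ 2 = \<delta> * cmod \<delta>' ^ 2"
      using m by (simp add: E1_def x_def)
    moreover have "\<delta> * cmod \<delta>' ^ 2 > 0" using delta_pos delta'_nonzero by simp
    ultimately have "x * cmod (elt' m (m1 m) (m2 m)) ^ 2 > 0" by simp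
    then have "x > 0" by (simp add: zero_less_mult_iff)
    show "m \<in> {\<lfloor>- K\<rfloor>..\<lceil>K\<rceil>} \<union> T ` {..<N}"
    proof (cases "\<delta> \<le> x")
      case True
      obtain s where s: "D dvd c0 m (m1 m) (m2 m) - c0 (T s) (T (Suc s)) (T (Suc (Suc s)))"
          "D dvd c1 m (m1 m) - c1 (T s) (T (Suc s))" "D dvd m - T s"
        using m E2_iff by blast
      then obtain n where n: "m = T n"
        using trace_if_norm_cong[OF r D[unfolded y_def y'_def] s norm[unfolded x_def]
            True[unfolded x_def]] by blast
      have "n < N"
      proof (rule ccontr)
        assume "\<not> n < N"
        then have "m = round (\<beta> ^ n)" using N[of n] n by simp
        then show False using m by (auto simp: A_def)
      qed
      then show ?thesis using n by blast
    next
      case False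
      have "\<bar>\<delta> * of_int m\<bar> \<le> \<delta> + (1 + \<bar>\<beta> - of_int a\<bar>)"
        using elt_approx[of m] False \<open>x > 0\<close> unfolding x_def by linarith
      then have "\<delta> * \<bar>of_int m\<bar> \<le> \<delta> * K"
        unfolding K_def distrib_left using delta_pos by (simp add: abs_mult)
      then have "\<bar>of_int m\<bar> \<le> K" using delta_pos by simp
      then have "- K \<le> of_int m" "of_int m \<le> K" by linarith+
      then have "m \<in> {\<lfloor>- K\<rfloor>..\<lceil>K\<rceil>}" by (simp, linarith)
      then show ?thesis by blast
    qed
  qed
  then have "finite (E1 \<inter> E2 - A)" by (rule finite_subset) simp
  ultimately show ?thesis
    using generalised_polynomial_set_finite_sym_diff[OF E] unfolding A_def by blast
qed

end

section \<open>Complex conjugates from the uniqueness of the real root\<close>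

theorem theorem6p21:
  fixes a b :: int and p :: "real poly" and \<beta> :: real
  assumes p: "p = [:- 1, - real_of_int b, - real_of_int a, 1:]"
    and ab: "(a \<ge> 0 \<and> 0 \<le> b \<and> b \<le> a + 1) \<or> (a \<ge> 2 \<and> b = - 1)"
    and unique_root: "\<exists>!x. poly p x = 0"
    and root: "poly p \<beta> = 0"
    and gt_1: "\<beta> > 1"
  shows "generalised_polynomial_set {round (\<beta> ^ n) | n :: nat. True}"
proof -
  have poly: "poly p x = x ^ 3 - of_int a * x ^ 2 - of_int b * x - 1" for x
    unfolding p by (simp add: algebra_simps power2_eq_square power3_eq_cube)
  have cubic: "\<beta> ^ 3 = of_int a * \<beta> ^ 2 + of_int b * \<beta> + 1"
    using root unfolding poly by simp
  \<comment> \<open>The quotient of p by x - \<beta> is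
    \<open>x ^ 2 + c * x + 1 / \<beta>\<close>.\<close>
  define c where "c = \<beta> - of_int a"
  have factor: "\<beta> * poly p x = \<beta> * ((x - \<beta>) * (x ^ 2 + c * x)) + (x - \<beta>)" for x
    unfolding poly c_def using cubic by algebra
  have unique: "x = \<beta>" if "\<beta> * (x ^ 2 + c * x) + 1 = 0" for x
  proof -
    have "\<beta> * poly p x = (x - \<beta>) * (\<beta> * (x ^ 2 + c * x) + 1)"
      unfolding factor by algebra
    then have "poly p x = 0" using that gt_1 by simp
    then show ?thesis using unique_root root by blast
  qed
  \<comment> \<open>Otherwise the quadratic factor has real roots, both equal to \<beta> by
    uniqueness. Then s = 0 and c = -2 \<beta>, which forces \<open>\<beta> ^ 3 = 1\<close>.\<close>
  have disc: "c ^ 2 < 4 / \<beta>"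
  proof (rule ccontr)
    assume "\<not> c ^ 2 < 4 / \<beta>"
    then have nonneg: "c ^ 2 - 4 / \<beta> \<ge> 0" by simp
    define s where "s = sqrt (c ^ 2 - 4 / \<beta>)"
    have s: "s ^ 2 = c ^ 2 - 4 / \<beta>" using nonneg by (simp add: s_def)
    then have s': "\<beta> * s ^ 2 = \<beta> * c ^ 2 - 4" using gt_1 by (simp add: field_simps)
    have "\<beta> * (((- c + s) / 2) ^ 2 + c * ((- c + s) / 2)) + 1 = 0"
      using s' by (simp add: field_simps power2_eq_square)
    then have 1: "(- c + s) / 2 = \<beta>" by (rule unique)
    have "\<beta> * (((- c - s) / 2) ^ 2 + c * ((- c - s) / 2)) + 1 = 0"
      using s' by (simp add: field_simps power2_eq_square)
    then have 2: "(- c - s) / 2 = \<beta>" by (rule unique)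
    have "s = 0" "c = - 2 * \<beta>" using 1 2 by simp_all
    then have "\<beta> ^ 3 = 1" using s' by (simp add: power2_eq_square power3_eq_cube)
    moreover have "\<beta> ^ 3 > 1" using gt_1 by simp
    ultimately show False by simp
  qed
  define t where "t = sqrt (4 / \<beta> - c ^ 2)"
  have t: "t ^ 2 = 4 / \<beta> - c ^ 2" "t > 0" using disc by (simp_all add: t_def)
  \<comment> \<open>\<gamma> is the root of the quadratic factor with positive imaginary
    part.\<close>
  interpret complex_cubic_pisot_unit a b \<beta> "Complex (- c / 2) (t / 2)"
  proof
    have "cmod (Complex (- c / 2) (t / 2)) ^ 2 = (c ^ 2 + t ^ 2) / 4"
      by (simp add: cmod_power2 power_divide)
    then show "\<beta> * cmod (Complex (- c / 2) (t / 2)) ^ 2 = 1"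
      unfolding t(1) using gt_1 by simp
  qed (use gt_1 cubic t in \<open>simp_all add: c_def\<close>)
  show ?thesis by (rule generalised_polynomial_set_round_power)
qed

end
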